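(* Let a cone of the form $N(x,A,B)$ correspond to an extreme point of (the credal set of) a coherent PRI model $(l,u)$ on a finite set $\mathcal X$. For $y\in A$ and $z\in B$ consider the cones (A1) $N(x,A\setminus\{y\},B\cup\{y\})$, (A2) $N(y,(A\setminus\{y\})\cup\{x\},B)$, (B1) $N(x,A\cup\{z\},B\setminus\{z\})$, (B2) $N(z,A,(B\setminus\{z\})\cup\{x\})$. Then: (i) The adjacent cones are exactly the cones of the form: (A2) for every $y\in A$; if $|A|>1$, (A1) for every $y\in A$; (B2) for every $z\in B$; if $|B|>1$, (B1) for every $z\in B$. (ii) For a given $y\in A$, (A1) corresponds to an extreme point if $$l(x)\le 1-\sum_{v\in A\setminus\{y\}}l(v)-\sum_{w\in B\cup\{y\}}u(w),$$ and (A2) corresponds to an extreme point if $$1-\sum_{v\in(A\setminus\{y\})\cup\{x\}}l(v)-\sum_{w\in B}u(w)\le u(y).$$ (iii) For a given $z\in B$, (B1) corresponds to an extreme point if $$1-\sum_{w\in A\cup\{z\}}l(w)-\sum_{v\in B\setminus\{z\}}u(v)\le u(x),$$ and (B2) corresponds to an extreme point if $$l(z)\le 1-\sum_{w\in A}l(w)-\sum_{v\in(B\setminus\{z\})\cup\{x\}}u(v).$$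
   Context: Let $n=|\mathcal X|$; real functions on $\mathcal X$ are identified with vectors in $\mathbb R^n$, and $\mathbb I_C$ is the indicator vector of $C\subseteq\mathcal X$. A probability interval (PRI) model is a pair $l,u\colon\mathcal X\to\mathbb R$ with $l\le u$; its credal set is $\mathcal M(l,u)=\{P\text{ probability on }\mathcal X\colon l(x)\le P(\{x\})\le u(x)\ \forall x\}$. It is coherent if $\mathcal M(l,u)\neq\emptyset$ and $l(x)=\min_{P\in\mathcal M(l,u)}P(\{x\})$, $u(x)=\max_{P\in\mathcal M(l,u)}P(\{x\})$ for all $x$. The normal cone at $P\in\mathcal M(l,u)$ is $\{f\in\mathbb R^n\colon P(f)\le Q(f)\ \forall Q\in\mathcal M(l,u)\}$, where $P(f)=\sum_xP(\{x\})f(x)$. For $x\in\mathcal X$ and nonempty disjoint $A,B\subset\mathcal X$ with $x\notin A\cup B$, $N(x,A,B)=\{f\in\mathbb R^n\colon f\le f(x)\text{ on }A,\ f\ge f(x)\text{ on }B,\ f=f(x)\text{ on }\mathcal X\setminus(A\cup B)\}$. A maximal elementary simplicial cone (MESC) in the PRI setting is a cone $\mathrm{cone}(\mathcal A)=\{\sum_{C\in\mathcal A\setminus\{\mathcal X\}}\alpha_C\mathbb I_C+\beta\mathbb I_{\mathcal X}\colon\alpha_C\ge0,\ \beta\in\mathbb R\}$ where $\mathcal A$ consists of $\mathcal X$ together with some sets of the form $\{y\}$ or $\{y\}^c$, the vectors $\mathbb I_C$, $C\in\mathcal A$, form a basis of $\mathbb R^n$, and $\mathbb I_D\notin\mathrm{cone}(\mathcal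 A)$ for every $D\notin\mathcal A$ of the form $\{y\}$ or $\{y\}^c$. Two MESCs are adjacent if they intersect in a common face of codimension 1 (dimension $n-1$). A MESC is said to correspond to an extreme point if it is contained in the normal cone of $\mathcal M(l,u)$ at some extreme point of $\mathcal M(l,u)$.
   Formalization: The normal cone at P is taken as {f : Q(f) ≤ P(f) for all Q}, the opposite inequality to the one in the setting; with the original sign parts (ii) and (iii) fail, e.g. for four points x, y, a, b with l=0, u=2/5, A={y,a}, B={b}. *)

theory Defs
  imports "HOL-Analysis.Analysis"
begin

text \<open>
  The finite set is the type \<open>'a\<close>, with n = \<open>CARD('a)\<close>. Real functions and probabilities (given by
  their mass functions) are vectors in \<open>real ^ 'a\<close>, so that the expectation P(f) is \<open>P \<bullet> f\<close>.
\<close>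

definition ind :: "'a set \<Rightarrow> real ^ 'a::finite" where
  "ind C = (\<chi> x. indicator C x)"

definition prob_vectors :: "(real ^ 'a::finite) set" where
  "prob_vectors = {P. (\<forall>x. 0 \<le> P $ x) \<and> (\<Sum>x\<in>UNIV. P $ x) = 1}"

definition credal :: "('a \<Rightarrow> real) \<Rightarrow> ('a \<Rightarrow> real) \<Rightarrow> (real ^ 'a::finite) set" where
  "credal l u = {P \<in> prob_vectors. \<forall>x. l x \<le> P $ x \<and> P $ x \<le> u x}"

definition coherent_PRI :: "('a::finite \<Rightarrow> real) \<Rightarrow> ('a \<Rightarrow> real) \<Rightarrow> bool" where
  "coherent_PRI l u \<longleftrightarrow>
     (\<forall>x. l x \<le> u x) \<and> credal l u \<noteq> {} \<and>
     (\<forall>x. (\<exists>P\<in>credal l u. P $ x = l x \<and> (\<forall>Q\<in>credal l u. P $ x \<le> Q $ x)) \<and>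
          (\<exists>P\<in>credal l u. P $ x = u x \<and> (\<forall>Q\<in>credal l u. Q $ x \<le> P $ x)))"

text \<open>
  Orientation: this is the outer normal cone of convex analysis, on which \<open>P\<close> is a maximiser. It is
  the negative of the set of f with P(f) \<open>\<le>\<close> Q(f) for all Q. The outer orientation is the one under
  which membership of \<open>N_cone x A B\<close> forces P = l on A and P = u on B, as the inequalities of the
  theorem presuppose. With the inner orientation they are wrong: on four points x, y, a, b
  with l = 0 and u = 2/5, \<open>N_cone x {y, a} {b}\<close> lies in an inner normal cone at an extreme point and
  l(x) \<open>\<le>\<close> 1 - l(a) - u(b) - u(y), but \<open>N_cone x {a} {b, y}\<close> lies in no inner normal cone.
\<close>

definition normal_cone :: "(real ^ 'a::finite) set \<Rightarrow> real ^ 'a \<Rightarrow> (real ^ 'a) set" where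
  "normal_cone M P = {f. \<forall>Q\<in>M. Q \<bullet> f \<le> P \<bullet> f}"

definition N_cone :: "'a \<Rightarrow> 'a set \<Rightarrow> 'a set \<Rightarrow> (real ^ 'a::finite) set" where
  "N_cone x A B = {f. (\<forall>v\<in>A. f $ v \<le> f $ x) \<and> (\<forall>w\<in>B. f $ x \<le> f $ w) \<and>
                      (\<forall>v\<in>UNIV - (A \<union> B). f $ v = f $ x)}"

definition elementary_sets :: "'a set set" where
  "elementary_sets = range (\<lambda>y. {y}) \<union> range (\<lambda>y. - {y})"

definition set_cone :: "'a set set \<Rightarrow> (real ^ 'a::finite) set" where
  "set_cone \<A> = {(\<Sum>C\<in>\<A> - {UNIV}. \<alpha> C *\<^sub>R ind C) + \<beta> *\<^sub>R ind UNIV | \<alpha> \<beta>.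
                   \<forall>C\<in>\<A> - {UNIV}. 0 \<le> \<alpha> C}"

text \<open>Since \<open>ind\<close> is injective, the image set below is a basis iff the family is one.\<close>

definition is_MESC :: "(real ^ 'a::finite) set \<Rightarrow> bool" where
  "is_MESC K \<longleftrightarrow>
     (\<exists>\<A>. UNIV \<in> \<A> \<and> \<A> \<subseteq> insert UNIV elementary_sets \<and>
          independent (ind ` \<A>) \<and> span (ind ` \<A>) = (UNIV :: (real ^ 'a) set) \<and>
          (\<forall>D \<in> elementary_sets - \<A>. ind D \<notin> set_cone \<A>) \<and>
          K = set_cone \<A>)"

definition adjacent :: "(real ^ 'a::finite) set \<Rightarrow> (real ^ 'a) set \<Rightarrow> bool" where
  "adjacent K K' \<longleftrightarrow>
     is_MESC K \<and> is_MESC K' \<and> (K \<inter> K') face_of K \<and> (K \<inter> K') face_of K' \<and>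
     aff_dim (K \<inter> K') = int CARD('a) - 1"

definition corresponds_to_extreme ::
  "('a::finite \<Rightarrow> real) \<Rightarrow> ('a \<Rightarrow> real) \<Rightarrow> (real ^ 'a) set \<Rightarrow> bool" where
  "corresponds_to_extreme l u K \<longleftrightarrow>
     (\<exists>P. P extreme_point_of (credal l u) \<and> K \<subseteq> normal_cone (credal l u) P)"

end

theory Submission
  imports Defs
begin

text \<open>
  A basis family contains exactly one of \<open>{y}\<close>, \<open>{y}\<^sup>c\<close> for all points \<open>y\<close> but one, so the MESCs are
  exactly the cones N(x,A,B) with A, B nonempty and partitioning the complement of x.
  A proper face of such a cone satisfies a tie f(y) = f(x) with y \<open>\<in>\<close> A \<open>\<union>\<close> B. A common face of dimension
  n - 1 spans a hyperplane, so two adjacent cones share the tied pair {x,y} and, off that pair,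
  the sets A and B; what remains is to choose which tied point is the apex and on which
  side the other one lies. Of the four choices one is the cone itself and one overlaps it in
  full dimension.

  N(x,A,B) lies in the normal cone at P iff P = l on A and P = u on B, which fixes
  P(x) = 1 - l(A) - u(B). Hence it corresponds to an extreme point iff
  l(x) \<open>\<le>\<close> 1 - l(A) - u(B) \<open>\<le>\<close> u(x). For each neighbour one of these two inequalities is inherited
  from the original cone.
\<close>

section \<open>Indicator vectors and convexity of the cones\<close>

lemma ind_nth [simp]: "ind C $ v = indicator C v"
  by (simp add: ind_def)

lemma ind_inject [simp]: "ind C = ind D \<longleftrightarrow> C = D"
  by (auto simp: vec_eq_iff indicator_def split: if_splits)

lemma ind_singleton: "ind {v} = axis v 1"
  by (auto simp: vec_eq_iff axis_def indicator_def)

lemma ind_Compl: "ind (- C) = ind UNIV - ind C"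
  by (auto simp: vec_eq_iff indicator_def)

lemma convex_N_cone: "convex (N_cone x A B)"
proof -
  have "N_cone x A B = (\<Inter>v\<in>A. {f. (axis v 1 - axis x 1) \<bullet> f \<le> 0}) \<inter>
          (\<Inter>w\<in>B. {f. (axis x 1 - axis w 1) \<bullet> f \<le> 0}) \<inter>
          (\<Inter>v\<in>UNIV - (A \<union> B). {f. (axis v 1 - axis x 1) \<bullet> f = 0})"
    by (auto simp: N_cone_def inner_diff_left inner_axis')
  then show ?thesis
    by (simp add: convex_INT convex_Int convex_halfspace_le convex_hyperplane)
qed

section \<open>Maximal elementary simplicial cones as partition cones\<close>

text \<open>On two points a singleton is also the complement of one, and on one point it is
  \<open>UNIV\<close>. From three points on, the kinds of generator are distinct, so sums and
  cardinalities over a family split by kind.\<close>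

lemma singleton_neq_Compl:
  fixes v w :: "'a::finite"
  assumes "CARD('a) \<ge> 3"
  shows "card (- {w}) \<noteq> 1" and "{v} \<noteq> - {w}" and "{v} \<noteq> UNIV"
proof -
  show *: "card (- {w}) \<noteq> 1"
    using assms by (simp add: Compl_eq_Diff_UNIV card_Diff_singleton)
  show "{v} \<noteq> - {w}"
    using * by (metis is_singletonI is_singleton_altdef)
  show "{v} \<noteq> UNIV"
  proof
    assume "{v} = UNIV"
    then have "CARD('a) = card {v}" by simp
    then show False using assms by simp
  qed
qed

lemma CARD_ge_3_of_partition:
  fixes x :: "'a::finite"
  assumes "A \<inter> B = {}" "A \<union> B = - {x}" "a \<in> A" "b \<in> B"
  shows "CARD('a) \<ge> 3"
proof -
  have "x \<noteq> a" "x \<noteq> b" "a \<noteq> b" using assms by auto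
  then have "card {x, a, b} = 3" by simp
  then show ?thesis by (metis card_mono finite subset_UNIV)
qed

lemma set_cone_eq_N_cone:
  fixes x :: "'a::finite"
  assumes n: "CARD('a) \<ge> 3" and AB: "A \<inter> B = {}" "A \<union> B = - {x}"
  shows "set_cone (insert UNIV ((\<lambda>w. {w}) ` B \<union> (\<lambda>v. - {v}) ` A)) = N_cone x A B"
proof -
  note ne = singleton_neq_Compl(2,3)[OF n]
  have D: "insert UNIV ((\<lambda>w. {w}) ` B \<union> (\<lambda>v. - {v}) ` A) - {UNIV} =
      (\<lambda>w. {w}) ` B \<union> (\<lambda>v. - {v}) ` A"
    using ne by auto
  have sum_gen: "(\<Sum>C\<in>(\<lambda>w. {w}) ` B \<union> (\<lambda>v. - {v}) ` A. \<alpha> C *\<^sub>R ind C) =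
      (\<Sum>w\<in>B. \<alpha> {w} *\<^sub>R ind {w}) + (\<Sum>v\<in>A. \<alpha> (- {v}) *\<^sub>R ind (- {v}))"
    for \<alpha> :: "'a set \<Rightarrow> real"
    using ne by (subst sum.union_disjoint) (auto simp: sum.reindex inj_on_def)
  have comb_nth: "((\<Sum>w\<in>B. b w *\<^sub>R ind {w}) + (\<Sum>v\<in>A. a v *\<^sub>R ind (- {v})) + \<beta> *\<^sub>R ind UNIV) $ y =
      (if y \<in> B then b y else 0) - (if y \<in> A then a y else 0) + ((\<Sum>v\<in>A. a v) + \<beta>)"
    for a b :: "'a \<Rightarrow> real" and \<beta> y
  proof -
    have delta: "(\<Sum>v\<in>C. c v * indicator {v} y) = (if y \<in> C then c y else 0)"
      for c :: "'a \<Rightarrow> real" and C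
      by (simp add: indicator_def if_distrib cong: if_cong)
    have "(\<Sum>v\<in>A. a v * indicator (- {v}) y) = (\<Sum>v\<in>A. a v - a v * indicator {v} y)"
      by (intro sum.cong) (auto simp: indicator_def)
    then show ?thesis
      by (simp add: sum_subtractf delta)
  qed
  show ?thesis
  proof (intro equalityI subsetI)
    fix f assume "f \<in> set_cone (insert UNIV ((\<lambda>w. {w}) ` B \<union> (\<lambda>v. - {v}) ` A))"
    then obtain \<alpha> \<beta> where
      f: "f = (\<Sum>w\<in>B. \<alpha> {w} *\<^sub>R ind {w}) + (\<Sum>v\<in>A. \<alpha> (- {v}) *\<^sub>R ind (- {v})) + \<beta> *\<^sub>R ind UNIV"
      and pos: "\<forall>w\<in>B. 0 \<le> \<alpha> {w}" "\<forall>v\<in>A. 0 \<le> \<alpha> (- {v})"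
      unfolding set_cone_def D sum_gen by auto
    show "f \<in> N_cone x A B"
      unfolding N_cone_def f mem_Collect_eq comb_nth using AB pos by auto
  next
    fix f :: "real ^ 'a" assume f: "f \<in> N_cone x A B"
    \<comment> \<open>As n \<open>\<ge>\<close> 3, the cardinality tells the generators \<open>{w}\<close> from the generators \<open>{v}\<^sup>c\<close>.\<close>
    define \<alpha> where "\<alpha> C = (if card C = 1 then f $ (the_elem C) - f $ x else f $ x - f $ the_elem (- C))"
      for C :: "'a set"
    \<comment> \<open>Every \<open>ind (- {v})\<close> with \<open>v \<in> A\<close> adds its
      coefficient at the apex; \<open>\<beta>\<close> takes the total back, so that the value there
      is \<open>f $ x\<close>.\<close>
    define \<beta> where "\<beta> = f $ x - (\<Sum>v\<in>A. f $ x - f $ v)"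
    have \<alpha>: "\<alpha> {w} = f $ w - f $ x" "\<alpha> (- {w}) = f $ x - f $ w" for w
      using singleton_neq_Compl(1)[OF n, of w] by (simp_all add: \<alpha>_def)
    have eq: "f = (\<Sum>w\<in>B. \<alpha> {w} *\<^sub>R ind {w}) + (\<Sum>v\<in>A. \<alpha> (- {v}) *\<^sub>R ind (- {v})) + \<beta> *\<^sub>R ind UNIV"
      unfolding vec_eq_iff comb_nth unfolding \<alpha> \<beta>_def using AB by auto
    show "f \<in> set_cone (insert UNIV ((\<lambda>w. {w}) ` B \<union> (\<lambda>v. - {v}) ` A))"
      unfolding set_cone_def D sum_gen mem_Collect_eq
    proof (intro exI conjI)
      show "f = (\<Sum>w\<in>B. \<alpha> {w} *\<^sub>R ind {w}) + (\<Sum>v\<in>A. \<alpha> (- {v}) *\<^sub>R ind (- {v})) + \<beta> *\<^sub>R ind UNIV"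
        by (rule eq)
      show "\<forall>C\<in>(\<lambda>w. {w}) ` B \<union> (\<lambda>v. - {v}) ` A. 0 \<le> \<alpha> C"
        using f by (auto simp: N_cone_def \<alpha>)
    qed
  qed
qed

lemma is_MESC_N_cone:
  fixes x :: "'a::finite"
  assumes AB: "A \<inter> B = {}" "A \<union> B = - {x}" and ne: "A \<noteq> {}" "B \<noteq> {}"
  shows "is_MESC (N_cone x A B)"
proof -
  obtain a b where ab: "a \<in> A" "b \<in> B" using ne by auto
  then have n: "CARD('a) \<ge> 3" using AB by (intro CARD_ge_3_of_partition)
  define \<A> where "\<A> = insert UNIV ((\<lambda>w. {w}) ` B \<union> (\<lambda>v. - {v}) ` A)"
  have cone: "set_cone \<A> = N_cone x A B"
    unfolding \<A>_def by (rule set_cone_eq_N_cone[OF n AB])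
  let ?S = "span (ind ` \<A>)"
  have U: "ind UNIV \<in> ?S" by (auto simp: \<A>_def intro: span_base)
  have S1: "ind {v} \<in> ?S" if "v \<noteq> x" for v
  proof (cases "v \<in> B")
    case True
    then show ?thesis by (auto simp: \<A>_def intro: span_base)
  next
    case False
    then have "v \<in> A" using that AB by auto
    then have "ind (- {v}) \<in> ?S" by (auto simp: \<A>_def intro: span_base)
    then have "ind UNIV - ind (- {v}) \<in> ?S" using U by (rule span_diff[rotated])
    then show ?thesis by (simp add: ind_Compl)
  qed
  \<comment> \<open>The apex has no generator of its own; its indicator is what the other points
    leave of \<open>ind UNIV\<close>.\<close>
  have "ind {x} = ind UNIV - (\<Sum>v\<in>-{x}. ind {v})"
    by (auto simp: vec_eq_iff indicator_def)
  moreover have "ind UNIV - (\<Sum>v\<in>-{x}. ind {v}) \<in> ?S"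
    using U S1 by (intro span_diff span_sum) auto
  ultimately have S: "axis v 1 \<in> ?S" for v
    using S1[of v] by (cases "v = x") (auto simp: ind_singleton)
  have span: "?S = UNIV"
  proof -
    have "f \<in> ?S" for f
      using S by (subst basis_expansion[symmetric, of f]) (auto simp: scalar_mult_eq_scaleR intro!: span_sum span_scale)
    then show ?thesis by auto
  qed
  \<comment> \<open>A spanning set of at most n vectors is independent, so an upper bound on the
    cardinality is enough.\<close>
  have "card (ind ` \<A> :: (real ^ 'a) set) \<le> card \<A>" by (rule card_image_le) simp
  also have "card \<A> \<le> Suc (card ((\<lambda>w. {w}) ` B \<union> (\<lambda>v. - {v}) ` A))"
    unfolding \<A>_def by (rule card_insert_le_m1) auto
  also have "card ((\<lambda>w. {w}) ` B \<union> (\<lambda>v. - {v}) ` A) \<le> card B + card A"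
    by (intro order_trans[OF card_Un_le] add_mono card_image_le) auto
  also have "card B + card A = card (- {x})"
    using AB by (metis card_Un_disjoint finite add.commute)
  also have "Suc (card (- {x})) = CARD('a)"
    using n by (simp add: Compl_eq_Diff_UNIV card_Diff_subset)
  finally have "card (ind ` \<A> :: (real ^ 'a) set) \<le> CARD('a)" by simp
  then have indep: "independent (ind ` \<A> :: (real ^ 'a) set)"
    using span by (intro card_le_dim_spanning[of _ UNIV]) auto
  \<comment> \<open>A set \<open>D\<close> built from \<open>v \<noteq> x\<close> puts
    \<open>v\<close> on the wrong side of the apex. For \<open>v = x\<close> the violation is at
    \<open>b\<close> if \<open>D = {x}\<close>, and at \<open>a\<close> if
    \<open>D = - {x}\<close>.\<close>
  have "ind D \<notin> N_cone x A B" if D: "D \<in> elementary_sets" "D \<notin> \<A>" for D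
  proof -
    consider v where "D = {v}" "v \<notin> B" | v where "D = - {v}" "v \<notin> A"
      using D unfolding elementary_sets_def \<A>_def by blast
    then show ?thesis
    proof cases
      case 1
      then show ?thesis using AB ab by (cases "v = x") (auto simp: N_cone_def indicator_def)
    next
      case 2
      then show ?thesis using AB ab by (cases "v = x") (auto simp: N_cone_def indicator_def)
    qed
  qed
  then show ?thesis
    unfolding is_MESC_def using span indep cone
    by (intro exI[of _ \<A>]) (auto simp: \<A>_def elementary_sets_def)
qed

text \<open>Since \<open>ind {y} + ind (- {y}) = ind UNIV\<close>, independence allows only one of
  the two sets. The n - 1 proper members of the basis then use n - 1 distinct points, and the point
  left over is the apex.\<close>

lemma is_MESC_E:
  fixes K :: "(real ^ 'a::finite) set"
  assumes "is_MESC K" and n: "CARD('a) \<ge> 3"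
  obtains x A B where "A \<inter> B = {}" "A \<union> B = - {x}" "A \<noteq> {}" "B \<noteq> {}" "K = N_cone x A B"
proof -
  obtain \<A> :: "'a set set" where \<A>: "UNIV \<in> \<A>" "\<A> \<subseteq> insert UNIV elementary_sets"
      and ind: "independent (ind ` \<A> :: (real ^ 'a) set)"
      and span: "span (ind ` \<A>) = (UNIV :: (real ^ 'a) set)"
      and max: "\<forall>D \<in> elementary_sets - \<A>. ind D \<notin> set_cone \<A>"
      and K: "K = set_cone \<A>"
    using assms(1) by (auto simp: is_MESC_def)
  define A where "A = {v. - {v} \<in> \<A>}"
  define B where "B = {w. {w} \<in> \<A>}"
  note ne = singleton_neq_Compl(2,3)[OF n]
  have \<A>_eq: "\<A> = insert UNIV ((\<lambda>w. {w}) ` B \<union> (\<lambda>v. - {v}) ` A)"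
    using \<A> by (auto simp: A_def B_def elementary_sets_def)
  have disj: "A \<inter> B = {}"
  proof (rule ccontr)
    assume "A \<inter> B \<noteq> {}"
    then obtain y where y: "{y} \<in> \<A>" "- {y} \<in> \<A>" by (auto simp: A_def B_def)
    have "ind C \<in> span (ind ` \<A> - {ind UNIV} :: (real ^ 'a) set)" if "C = {y} \<or> C = - {y}" for C
      using that y ne(2)[of y] by (intro span_base) auto
    then have "ind {y} + ind (- {y}) \<in> span (ind ` \<A> - {ind UNIV} :: (real ^ 'a) set)"
      by (intro span_add) auto
    then have "ind UNIV \<in> span (ind ` \<A> - {ind UNIV} :: (real ^ 'a) set)"
      by (simp add: ind_Compl)
    then show False using ind \<A>(1) unfolding dependent_def by blast
  qed
  have "card \<A> = card (ind ` \<A> :: (real ^ 'a) set)"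
    by (subst card_image) (auto simp: inj_on_def)
  also have "\<dots> = CARD('a)"
    using ind span by (metis DIM_cart DIM_real dim_UNIV dim_eq_card mult.right_neutral span_UNIV)
  finally have "card \<A> = CARD('a)" .
  moreover have "card \<A> = Suc (card (A \<union> B))"
  proof -
    have "card \<A> = Suc (card ((\<lambda>w. {w}) ` B \<union> (\<lambda>v. - {v}) ` A))"
      unfolding \<A>_eq using ne by (subst card_insert_disjoint) auto
    also have "card ((\<lambda>w. {w}) ` B \<union> (\<lambda>v. - {v}) ` A) = card B + card A"
      using ne by (subst card_Un_disjoint) (auto simp: card_image inj_on_def)
    finally show ?thesis using disj by (simp add: card_Un_disjoint)
  qed
  ultimately have "card (- (A \<union> B)) = 1" by (simp add: Compl_eq_Diff_UNIV card_Diff_subset)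
  then obtain x where "- (A \<union> B) = {x}" by (auto simp: card_1_singleton_iff)
  then have un: "A \<union> B = - {x}" by auto
  have cone: "set_cone \<A> = N_cone x A B"
    unfolding \<A>_eq by (rule set_cone_eq_N_cone[OF n disj un])
  have x: "x \<notin> A" "x \<notin> B" using un by auto
  \<comment> \<open>With \<open>A\<close> empty, \<open>ind (- {x})\<close> is the sum of the
    generators \<open>ind {w}\<close>, against maximality. An empty \<open>B\<close> fails dually
    through \<open>ind {x}\<close>.\<close>
  have "A \<noteq> {}"
  proof
    assume "A = {}"
    then have "ind (- {x}) \<in> N_cone x A B" using un by (auto simp: N_cone_def indicator_def)
    moreover have "- {x} \<in> elementary_sets - \<A>" using x by (auto simp: A_def elementary_sets_def)
    ultimately show False using max cone by blast
  qed
  moreover have "B \<noteq> {}"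
  proof
    assume "B = {}"
    then have "ind {x} \<in> N_cone x A B" using un by (auto simp: N_cone_def indicator_def)
    moreover have "{x} \<in> elementary_sets - \<A>" using x by (auto simp: B_def elementary_sets_def)
    ultimately show False using max cone by blast
  qed
  ultimately show ?thesis using that disj un K cone by blast
qed

text \<open>A further point \<open>v\<close> outside \<open>A \<union> B\<close> would be tied to
  \<open>x\<close>, confining the cone to a hyperplane, whereas a MESC contains a basis. This turns
  the hypotheses of the theorem into the partition on which all other lemmas rely.\<close>

lemma is_MESC_N_cone_partition:
  fixes x :: "'a::finite"
  assumes "is_MESC (N_cone x A B)" and "x \<notin> A \<union> B"
  shows "A \<union> B = - {x}"
proof (rule ccontr)
  assume "A \<union> B \<noteq> - {x}"
  then obtain v where v: "v \<noteq> x" "v \<notin> A \<union> B" using assms(2) by auto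
  obtain \<A> :: "'a set set" where span: "span (ind ` \<A>) = (UNIV :: (real ^ 'a) set)"
      and K: "N_cone x A B = set_cone \<A>"
    using assms(1) by (auto simp: is_MESC_def)
  have mem: "ind C \<in> set_cone \<A>" if "C \<in> \<A>" for C
  proof (cases "C = UNIV")
    case True
    then show ?thesis
      by (auto simp: set_cone_def intro!: exI[of _ "\<lambda>_. 0"] exI[of _ 1])
  next
    case False
    have "(\<Sum>D\<in>\<A> - {UNIV}. (if D = C then 1 else 0) *\<^sub>R ind D) = (ind C :: real ^ 'a)"
      using that False by (simp add: if_distrib[of "\<lambda>r. r *\<^sub>R _"] cong: if_cong)
    then show ?thesis
      unfolding set_cone_def mem_Collect_eq
      by (intro exI[of _ "\<lambda>D. if D = C then 1 else 0"] exI[of _ 0]) simp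
  qed
  let ?H = "{f :: real ^ 'a. (axis v 1 - axis x 1) \<bullet> f = 0}"
  have "ind ` \<A> \<subseteq> ?H"
    using mem v unfolding K[symmetric] by (fastforce simp: N_cone_def inner_diff_left inner_axis')
  then have "span (ind ` \<A>) \<subseteq> ?H"
    by (rule span_minimal) (rule subspace_hyperplane)
  then have "ind {v} \<in> ?H" using span by blast
  then show False using v by (simp add: inner_diff_left inner_axis')
qed

section \<open>Facets of partition cones\<close>

lemma N_cone_partition_iff:
  assumes "A \<union> B = - {x}"
  shows "f \<in> N_cone x A B \<longleftrightarrow> (\<forall>v\<in>A. f $ v \<le> f $ x) \<and> (\<forall>w\<in>B. f $ x \<le> f $ w)"
  unfolding N_cone_def assms by auto

lemma tie_hyperplane_ne_0: "y \<noteq> x \<Longrightarrow> (axis y 1 - axis x 1 :: real ^ 'a::finite) \<noteq> 0"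
  by (metis axis_eq_axis eq_iff_diff_eq_0 zero_neq_one)

text \<open>Deleting \<open>y\<close> from both sets treats \<open>y \<in> A\<close> and
  \<open>y \<in> B\<close> alike: one deletion is vacuous, and the last clause of
  \<open>N_cone_def\<close> then ties \<open>y\<close> to \<open>x\<close>.\<close>

lemma facet_eq_Int_hyperplane:
  assumes "A \<inter> B = {}" "A \<union> B = - {x}" and "y \<in> A \<union> B"
  shows "N_cone x (A - {y}) (B - {y}) = N_cone x A B \<inter> {f. (axis y 1 - axis x 1) \<bullet> f = 0}"
proof -
  have "UNIV - ((A - {y}) \<union> (B - {y})) = {x, y}"
    using assms by auto
  then have "f \<in> N_cone x (A - {y}) (B - {y}) \<longleftrightarrow>
      (\<forall>v\<in>A - {y}. f $ v \<le> f $ x) \<and> (\<forall>w\<in>B - {y}. f $ x \<le> f $ w) \<and> f $ y = f $ x" for f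
    by (simp add: N_cone_def)
  then show ?thesis
    by (auto simp: N_cone_partition_iff[OF assms(2)] inner_diff_left inner_axis')
       (metis order_refl DiffI singletonD)+
qed

text \<open>The tie hyperplane supports the cone, which lies in one of its half-spaces according to
  the side of \<open>y\<close>.\<close>

lemma facet_face_of:
  assumes AB: "A \<inter> B = {}" "A \<union> B = - {x}" and y: "y \<in> A \<union> B"
  shows "N_cone x (A - {y}) (B - {y}) face_of N_cone x A B"
proof (cases "y \<in> A")
  case True
  then show ?thesis
    unfolding facet_eq_Int_hyperplane[OF assms]
    by (intro face_of_Int_supporting_hyperplane_le convex_N_cone)
       (auto simp: N_cone_def inner_diff_left inner_axis')
next
  case False
  then show ?thesis
    unfolding facet_eq_Int_hyperplane[OF assms] using y
    by (intro face_of_Int_supporting_hyperplane_ge convex_N_cone)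
       (auto simp: N_cone_def inner_diff_left inner_axis')
qed

text \<open>Points outside \<open>A \<union> B\<close> are left free, which keeps the set open for
  all \<open>A\<close> and \<open>B\<close>. For a partition it lies inside the cone; with
  \<open>y\<close> deleted, its trace on the tie hyperplane lies inside the facet.\<close>

definition N_open :: "'a \<Rightarrow> 'a set \<Rightarrow> 'a set \<Rightarrow> (real ^ 'a::finite) set" where
  "N_open x A B = {f. (\<forall>v\<in>A. f $ v < f $ x) \<and> (\<forall>w\<in>B. f $ x < f $ w)}"

lemma open_N_open: "open (N_open x A B)"
proof -
  have "N_open x A B = (\<Inter>v\<in>A. {f. f $ v < f $ x}) \<inter> (\<Inter>w\<in>B. {f. f $ x < f $ w})"
    by (auto simp: N_open_def)
  then show ?thesis
    by (auto intro!: open_Int open_INT open_Collect_less continuous_intros)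
qed

text \<open>The facet lies between the tie hyperplane and the trace of an open set on it. A nonempty
  trace of this kind already has the whole hyperplane as affine hull.\<close>

lemma aff_dim_facet:
  fixes x :: "'a::finite"
  assumes AB: "A \<inter> B = {}" "A \<union> B = - {x}" and y: "y \<in> A \<union> B"
  shows "aff_dim (N_cone x (A - {y}) (B - {y})) = int CARD('a) - 1"
proof -
  define H where "H = {f :: real ^ 'a. (axis y 1 - axis x 1) \<bullet> f = 0}"
  let ?T = "N_open x (A - {y}) (B - {y})"
  have yx: "y \<noteq> x" using AB y by auto
  have dim: "aff_dim H = int CARD('a) - 1"
    unfolding H_def using tie_hyperplane_ne_0[OF yx] by (subst aff_dim_hyperplane) auto
  \<comment> \<open>The witness takes the value 0 at both \<open>x\<close> and \<open>y\<close>, and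
    satisfies all other inequalities strictly.\<close>
  have "(\<chi> v. if v \<in> A - {y} then -1 else if v \<in> B - {y} then 1 else 0) \<in> H \<inter> ?T"
    using AB y by (auto simp: H_def N_open_def inner_diff_left inner_axis')
  then have "H \<inter> ?T \<noteq> {}" by blast
  moreover have "convex H" unfolding H_def by (rule convex_hyperplane)
  ultimately have "affine hull (H \<inter> ?T) = affine hull H"
    using open_N_open by (intro affine_hull_convex_Int_open) auto
  then have "aff_dim (H \<inter> ?T) = aff_dim H" by (metis aff_dim_affine_hull)
  moreover have "H \<inter> ?T \<subseteq> N_cone x (A - {y}) (B - {y})"
  proof
    fix f assume "f \<in> H \<inter> ?T"
    then have f: "f $ y = f $ x" "f \<in> ?T"
      by (auto simp: H_def inner_diff_left inner_axis')
    then have "f $ v \<le> f $ x" if "v \<in> A" for v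
      using that by (cases "v = y") (auto simp: N_open_def less_imp_le)
    moreover have "f $ x \<le> f $ w" if "w \<in> B" for w
      using that f by (cases "w = y") (auto simp: N_open_def less_imp_le)
    ultimately show "f \<in> N_cone x (A - {y}) (B - {y})"
      unfolding facet_eq_Int_hyperplane[OF assms]
      by (simp add: N_cone_partition_iff[OF AB(2)] f(1) inner_diff_left inner_axis')
  qed
  moreover have "N_cone x (A - {y}) (B - {y}) \<subseteq> H"
    unfolding facet_eq_Int_hyperplane[OF assms] H_def by blast
  ultimately show ?thesis using dim aff_dim_subset by (metis order_antisym)
qed

section \<open>Adjacent cones and their tied pair\<close>

text \<open>The hypotheses \<open>tie\<close>, \<open>sub1\<close> and \<open>sub2\<close> identify
  the intersection with a facet of each cone, so the facet lemmas supply both the face property and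
  the dimension.\<close>

lemma adjacent_N_cone:
  assumes 1: "A \<inter> B = {}" "A \<union> B = - {x}" "A \<noteq> {}" "B \<noteq> {}" "y \<in> A \<union> B"
    and 2: "A' \<inter> B' = {}" "A' \<union> B' = - {x'}" "A' \<noteq> {}" "B' \<noteq> {}" "y' \<in> A' \<union> B'"
    and tie: "\<And>f. f \<in> N_cone x A B \<Longrightarrow> f \<in> N_cone x' A' B' \<Longrightarrow> f $ y = f $ x \<and> f $ y' = f $ x'"
    and sub1: "\<And>f. f \<in> N_cone x A B \<Longrightarrow> f $ y = f $ x \<Longrightarrow> f \<in> N_cone x' A' B'"
    and sub2: "\<And>f. f \<in> N_cone x' A' B' \<Longrightarrow> f $ y' = f $ x' \<Longrightarrow> f \<in> N_cone x A B"
  shows "adjacent (N_cone x A B) (N_cone x' A' B')"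
proof -
  have I1: "N_cone x A B \<inter> N_cone x' A' B' = N_cone x (A - {y}) (B - {y})"
    unfolding facet_eq_Int_hyperplane[OF 1(1,2,5)] using tie sub1
    by (auto simp: inner_diff_left inner_axis')
  have I2: "N_cone x A B \<inter> N_cone x' A' B' = N_cone x' (A' - {y'}) (B' - {y'})"
    unfolding facet_eq_Int_hyperplane[OF 2(1,2,5)] using tie sub2
    by (auto simp: inner_diff_left inner_axis')
  show ?thesis
    unfolding adjacent_def
    using is_MESC_N_cone[OF 1(1-4)] is_MESC_N_cone[OF 2(1-4)]
      facet_face_of[OF 1(1,2,5), folded I1] facet_face_of[OF 2(1,2,5), folded I2]
      aff_dim_facet[OF 1(1,2,5), folded I1]
    by simp
qed

text \<open>A proper face avoids the interior of the cone, so its points cannot between them break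
  every tie.\<close>

lemma proper_face_tie:
  fixes x :: "'a::finite"
  assumes AB: "A \<inter> B = {}" "A \<union> B = - {x}" "A \<noteq> {}"
    and F: "F face_of N_cone x A B" "F \<noteq> N_cone x A B"
  obtains y where "y \<in> A \<union> B" "\<And>f. f \<in> F \<Longrightarrow> f $ y = f $ x"
proof (rule ccontr)
  assume "\<not> thesis"
  then have "\<forall>y\<in>A \<union> B. \<exists>f\<in>F. f $ y \<noteq> f $ x" using that by blast
  then obtain p where p: "\<And>y. y \<in> A \<union> B \<Longrightarrow> p y \<in> F" "\<And>y. y \<in> A \<union> B \<Longrightarrow> p y $ y \<noteq> p y $ x"
    by metis
  \<comment> \<open>Averaging witnesses against each single tie gives a point of \<open>F\<close> interior to the cone.\<close>
  define m where "m = card (A \<union> B)"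
  have m: "real m > 0" using AB(3) by (auto simp: m_def card_gt_0_iff)
  define q where "q = (\<Sum>y\<in>A \<union> B. (1 / m) *\<^sub>R p y)"
  have pK: "p y \<in> N_cone x A B" if "y \<in> A \<union> B" for y
    using p(1)[OF that] F(1) by (auto dest: face_of_imp_subset)
  have qF: "q \<in> F"
    unfolding q_def using m p(1) face_of_imp_convex[OF F(1)]
    by (intro convex_sum) (auto simp: m_def)
  have q_diff: "q $ v - q $ w = (1 / m) * (\<Sum>y\<in>A \<union> B. p y $ v - p y $ w)" for v w
    by (simp add: q_def sum_subtractf sum_distrib_left[symmetric] right_diff_distrib sum_divide_distrib[symmetric] diff_divide_distrib)
  have "q $ x - q $ v > 0" if "v \<in> A" for v
  proof -
    have "(\<Sum>y\<in>A \<union> B. p y $ x - p y $ v) > 0"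
      using that pK p(2)[of v] by (intro sum_pos2[of _ v]) (auto simp: N_cone_def less_le)
    then show ?thesis unfolding q_diff using m by simp
  qed
  moreover have "q $ w - q $ x > 0" if "w \<in> B" for w
  proof -
    have "(\<Sum>y\<in>A \<union> B. p y $ w - p y $ x) > 0"
      using that pK p(2)[of w] by (intro sum_pos2[of _ w]) (auto simp: N_cone_def less_le)
    then show ?thesis unfolding q_diff using m by simp
  qed
  ultimately have "q \<in> N_open x A B" by (simp add: N_open_def)
  moreover have "N_open x A B \<subseteq> N_cone x A B"
    using AB by (auto simp: N_open_def N_cone_def)
  ultimately have "q \<in> interior (N_cone x A B)"
    using open_N_open by (meson interiorI)
  then show False using face_of_disjoint_interior[OF F] qF by blast
qed

text \<open>Bookkeeping for the second cone of an adjacent pair: once all points off the tied pair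
  are on their sides, only the tied point that is not the apex remains to be placed.\<close>

lemma partition_insert_cases:
  assumes sub: "C \<subseteq> A" "D \<subseteq> B" and CD: "C \<union> D = - {x, y}"
    and AB: "A \<inter> B = {}" "A \<union> B = - {x}" and yx: "y \<noteq> x"
  shows "A = (if y \<in> A then insert y C else C)" and "B = (if y \<in> A then D else insert y D)"
proof -
  have CD': "v \<in> C \<or> v \<in> D \<longleftrightarrow> v \<noteq> x \<and> v \<noteq> y" for v
    using CD by (simp add: set_eq_iff)
  have AB': "v \<in> A \<longleftrightarrow> v \<noteq> x \<and> v \<notin> B" and B': "x \<notin> B" for v
    using AB by (auto simp: set_eq_iff)
  have eqs: "v \<in> A \<longleftrightarrow> v = y \<and> y \<in> A \<or> v \<in> C" "v \<in> B \<longleftrightarrow> v = y \<and> y \<in> B \<or> v \<in> D" for v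
    using CD'[of v] AB'[of v] B' sub by auto
  have "y \<in> A \<longleftrightarrow> y \<notin> B"
    using AB'[of y] yx by simp
  then show "A = (if y \<in> A then insert y C else C)" "B = (if y \<in> A then D else insert y D)"
    by (intro set_eqI; subst eqs; simp)+
qed

lemma adjacent_imp_neighbour:
  fixes x :: "'a::finite"
  assumes AB: "A \<inter> B = {}" "A \<union> B = - {x}" "A \<noteq> {}" "B \<noteq> {}"
    and adj: "adjacent (N_cone x A B) K"
  shows "(\<exists>y\<in>A. K = N_cone y ((A - {y}) \<union> {x}) B) \<or>
         (\<exists>y\<in>A. card A > 1 \<and> K = N_cone x (A - {y}) (B \<union> {y})) \<or>
         (\<exists>z\<in>B. K = N_cone z A ((B - {z}) \<union> {x})) \<or>
         (\<exists>z\<in>B. card B > 1 \<and> K = N_cone x (A \<union> {z}) (B - {z}))"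
proof -
  obtain a b where ab: "a \<in> A" "b \<in> B" using AB by auto
  then have n: "CARD('a) \<ge> 3" using AB by (intro CARD_ge_3_of_partition)
  obtain x' A' B' where AB': "A' \<inter> B' = {}" "A' \<union> B' = - {x'}" "A' \<noteq> {}" "B' \<noteq> {}"
      and K: "K = N_cone x' A' B'"
    using adj is_MESC_E[OF _ n] unfolding adjacent_def by metis
  define F where "F = N_cone x A B \<inter> K"
  have F: "F face_of N_cone x A B" "F face_of N_cone x' A' B'" "aff_dim F = int CARD('a) - 1"
    using adj by (auto simp: adjacent_def F_def K)
  \<comment> \<open>Partition cones have full dimension, so \<open>F\<close>, of dimension one less,
    is a proper face of both cones, as \<open>proper_face_tie\<close> requires.\<close>
  have full: "aff_dim (N_cone v C D) = int CARD('a)"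
    if "C \<inter> D = {}" "C \<union> D = - {v}" for v :: 'a and C D
  proof -
    have "(\<chi> w. if w \<in> C then -1 else if w \<in> D then 1 else 0) \<in> N_open v C D"
      using that by (auto simp: N_open_def)
    then have "N_open v C D \<noteq> {}" by blast
    then have "aff_dim (N_open v C D) = int CARD('a)"
      using open_N_open by (subst aff_dim_open) auto
    moreover have "N_open v C D \<subseteq> N_cone v C D"
      using that by (auto simp: N_open_def N_cone_def)
    ultimately show ?thesis
      using aff_dim_subset[of "N_open v C D" "N_cone v C D"] aff_dim_le_DIM[of "N_cone v C D"] by simp
  qed
  have "F \<noteq> N_cone x A B" "F \<noteq> N_cone x' A' B'"
    using F(3) full[OF AB(1,2)] full[OF AB'(1,2)] by auto
  then obtain y y' where y: "y \<in> A \<union> B" "\<And>f. f \<in> F \<Longrightarrow> f $ y = f $ x"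
      and y': "y' \<in> A' \<union> B'" "\<And>f. f \<in> F \<Longrightarrow> f $ y' = f $ x'"
    using proper_face_tie[OF AB(1-3) F(1)] proper_face_tie[OF AB'(1-3) F(2)] by metis
  have yx: "y \<noteq> x" "y' \<noteq> x'" using y y' AB AB' by auto
  \<comment> \<open>The affine hull of \<open>F\<close> is a hyperplane, so \<open>F\<close> admits only one tie.\<close>
  have tie: "{v, w} = {x, y}" if vw: "v \<noteq> w" "\<And>f. f \<in> F \<Longrightarrow> f $ v = f $ w" for v w
  proof -
    define H where "H v w = {f :: real ^ 'a. (axis v 1 - axis w 1) \<bullet> f = 0}" for v w
    have hull: "affine hull F = H v w" if "v \<noteq> w" "\<And>f. f \<in> F \<Longrightarrow> f $ v = f $ w" for v w
    proof -
      have "affine hull F = affine hull (H v w)"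
      proof (rule aff_dim_eq_full_gen[THEN iffD1])
        show "F \<subseteq> H v w" using that by (auto simp: H_def inner_diff_left inner_axis')
        show "aff_dim F = aff_dim (H v w)"
          unfolding H_def F(3) using tie_hyperplane_ne_0[OF that(1)]
          by (subst aff_dim_hyperplane) auto
      qed
      then show ?thesis by (simp add: H_def affine_hyperplane)
    qed
    have "H v w = H y x" using hull[OF vw] hull[OF yx(1) y(2)] by auto
    \<comment> \<open>Two indicator vectors recover the pair from its hyperplane:
      \<open>ind {v, w}\<close> lies on it and \<open>ind {v}\<close> does not.\<close>
    moreover have "ind {v, w} \<in> H v w" using vw by (simp add: H_def inner_diff_left inner_axis')
    ultimately have 1: "ind {v, w} \<in> H y x" by simp
    have "ind {v} \<notin> H v w" using vw by (simp add: H_def inner_diff_left inner_axis')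
    then have 2: "ind {v} \<notin> H y x" using \<open>H v w = H y x\<close> by simp
    have "(y = v \<or> y = w) = (x = v \<or> x = w)"
      using 1 by (auto simp: H_def inner_diff_left inner_axis' indicator_def split: if_splits)
    moreover have "(y = v) \<noteq> (x = v)"
      using 2 by (auto simp: H_def inner_diff_left inner_axis' indicator_def split: if_splits)
    ultimately show ?thesis by auto
  qed
  have pair: "{x', y'} = {x, y}" using tie[OF yx(2) y'(2)] by auto
  have eq: "f $ x' = f $ x" if "f \<in> F" for f
    using pair y(2)[OF that] by (auto simp: doubleton_eq_iff)
  have strict: "\<exists>f\<in>F. f $ v \<noteq> f $ x" if "v \<noteq> x" "v \<noteq> y" for v
    using tie[of v x] that by (metis doubleton_eq_iff)
  \<comment> \<open>Some point of \<open>F\<close> separates \<open>v\<close> from \<open>x\<close>.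
    As it lies in both cones and \<open>x'\<close> has the same value as \<open>x\<close>, it also
    decides the side of \<open>v\<close> in the second cone.\<close>
  have inA: "v \<in> A'" if v: "v \<in> A" "v \<noteq> y" for v
  proof -
    have vx: "v \<noteq> x" using v AB(2) by blast
    obtain f where f: "f \<in> F" "f $ v \<noteq> f $ x" using strict[OF vx v(2)] by blast
    have "f $ v < f $ x'" using f v eq[OF f(1)] by (auto simp: F_def N_cone_partition_iff[OF AB(2)] less_le)
    moreover have "f \<in> N_cone x' A' B'" using f by (simp add: F_def K)
    ultimately have "v \<noteq> x'" "v \<notin> B'" by (auto simp: N_cone_partition_iff[OF AB'(2)])
    then show ?thesis using AB'(2) by blast
  qed
  have inB: "v \<in> B'" if v: "v \<in> B" "v \<noteq> y" for v
  proof -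
    have vx: "v \<noteq> x" using v AB(2) by blast
    obtain f where f: "f \<in> F" "f $ v \<noteq> f $ x" using strict[OF vx v(2)] by blast
    have "f $ v > f $ x'" using f v eq[OF f(1)] by (auto simp: F_def N_cone_partition_iff[OF AB(2)] less_le)
    moreover have "f \<in> N_cone x' A' B'" using f by (simp add: F_def K)
    ultimately have "v \<noteq> x'" "v \<notin> A'" by (auto simp: N_cone_partition_iff[OF AB'(2)])
    then show ?thesis using AB'(2) by blast
  qed
  have big: "card C > 1" if "v \<in> C" "C - {v} \<noteq> {}" for C and v :: 'a
    using that by (metis card_gt_0_iff card_Diff_singleton finite zero_less_diff)
  have nF: "f \<notin> N_cone x' A' B'" if "f \<in> N_cone x A B" "f $ y \<noteq> f $ x" for f
    using that y(2) by (auto simp: F_def K)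
  have subA: "A - {y} \<subseteq> A'" "B - {y} \<subseteq> B'" using inA inB by auto
  have un: "(A - {y}) \<union> (B - {y}) = - {x', y'}" using AB(2) pair by auto
  note split = partition_insert_cases[OF subA un AB'(1,2) yx(2)]
  have split_in: "A' = insert y' (A - {y})" "B' = B - {y}" if "y' \<in> A'"
    by (fact split[unfolded if_P[OF that]])+
  have split_out: "A' = A - {y}" "B' = insert y' (B - {y})" if "y' \<notin> A'"
    by (fact split[unfolded if_not_P[OF that]])+
  have pw: "v \<noteq> x \<and> v \<notin> B" if "v \<in> A" for v
    using that AB(1,2) by blast
  have pw': "v \<noteq> x \<and> v \<notin> A" if "v \<in> B" for v
    using that AB(1,2) by blast
  \<comment> \<open>In each case \<open>g\<close> lies in the original cone without tying \<open>x\<close> and \<open>y\<close>, which rules out the two placements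
    of \<open>y'\<close> whose cone contains \<open>g\<close>.\<close>
  show ?thesis
  proof (cases "y \<in> A")
    case yA: True
    have yA': "y \<notin> B" using yA AB(1) by blast
    define g :: "real ^ 'a" where
      "g = (\<chi> v. if v = x then 2 else if v = y then 1 else if v \<in> A then 0 else 3)"
    have gxy: "g $ x = 2" "g $ y = 1" using yx by (simp_all add: g_def)
    have gA: "g $ v = 0" if "v \<in> A" "v \<noteq> y" for v
      using that pw by (auto simp: g_def)
    have gB: "g $ v = 3" if "v \<in> B" "v \<noteq> y" for v
      using that pw' by (auto simp: g_def)
    note g = gxy gA gB
    have gK: "g \<in> N_cone x A B"
      unfolding N_cone_partition_iff[OF AB(2)]
    proof (intro conjI ballI)
      show "g $ v \<le> g $ x" if "v \<in> A" for v
        using that yA' by (cases "v = y") (simp_all add: g)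
      show "g $ x \<le> g $ v" if "v \<in> B" for v
        using that yA' by (cases "v = y") (simp_all add: g)
    qed
    show ?thesis
    proof (cases "x' = x")
      case x'xy: True
      then have y'xy: "y' = y" using pair yx by (auto simp: doubleton_eq_iff)
      have side: "y \<notin> A'"
      proof (rule ccontr)
        assume "\<not> y \<notin> A'"
        then have "y' \<in> A'" using y'xy by simp
        note eq = split_in[OF this, unfolded y'xy]
        have "g \<in> N_cone x' A' B'"
          unfolding N_cone_partition_iff[OF AB'(2)] unfolding eq x'xy
          by (simp add: g del: insert_Diff_single)
        then show False using nF[OF gK] gxy by simp
      qed
      have "B - {y} = B" using yA' by auto
      then have eq': "A' = A - {y}" "B' = B \<union> {y}"
        using split_out[unfolded y'xy, OF side] by simp_all
      \<comment> \<open>The restriction on \<open>card A\<close> arises here: the second cone, being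
        a MESC, has a nonempty \<open>A'\<close>.\<close>
      have "A - {y} \<noteq> {}" using eq' AB'(3,4) by simp
      then have "card A > 1" by (rule big[OF yA])
      then show ?thesis using K eq' x'xy yA by blast
    next
      case False
      then have x'xy: "x' = y" and y'xy: "y' = x" using pair by (auto simp: doubleton_eq_iff)
      have side: "x \<in> A'"
      proof (rule ccontr)
        assume "\<not> x \<in> A'"
        then have "y' \<notin> A'" using y'xy by simp
        note eq = split_out[OF this, unfolded y'xy]
        have "g \<in> N_cone x' A' B'"
          unfolding N_cone_partition_iff[OF AB'(2)] unfolding eq x'xy
          by (simp add: g del: insert_Diff_single)
        then show False using nF[OF gK] gxy by simp
      qed
      have "B - {y} = B" using yA' by auto
      then have eq': "A' = (A - {y}) \<union> {x}" "B' = B"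
        using split_in[unfolded y'xy, OF side] by simp_all
      show ?thesis unfolding K eq' x'xy using yA by blast
    qed
  next
    case False
    then have yB: "y \<in> B" using y(1) by blast
    have yB': "y \<notin> A" using yB AB(1) by blast
    define g :: "real ^ 'a" where
      "g = (\<chi> v. if v = x then 1 else if v = y then 2 else if v \<in> A then 0 else 3)"
    have gxy: "g $ x = 1" "g $ y = 2" using yx by (simp_all add: g_def)
    have gA: "g $ v = 0" if "v \<in> A" "v \<noteq> y" for v
      using that pw by (auto simp: g_def)
    have gB: "g $ v = 3" if "v \<in> B" "v \<noteq> y" for v
      using that pw' by (auto simp: g_def)
    note g = gxy gA gB
    have gK: "g \<in> N_cone x A B"
      unfolding N_cone_partition_iff[OF AB(2)]
    proof (intro conjI ballI)
      show "g $ v \<le> g $ x" if "v \<in> A" for v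
        using that yB' by (cases "v = y") (simp_all add: g)
      show "g $ x \<le> g $ v" if "v \<in> B" for v
        using that yB' by (cases "v = y") (simp_all add: g)
    qed
    show ?thesis
    proof (cases "x' = x")
      case x'xy: True
      then have y'xy: "y' = y" using pair yx by (auto simp: doubleton_eq_iff)
      have side: "y \<in> A'"
      proof (rule ccontr)
        assume "\<not> y \<in> A'"
        then have "y' \<notin> A'" using y'xy by simp
        note eq = split_out[OF this, unfolded y'xy]
        have "g \<in> N_cone x' A' B'"
          unfolding N_cone_partition_iff[OF AB'(2)] unfolding eq x'xy
          by (simp add: g del: insert_Diff_single)
        then show False using nF[OF gK] gxy by simp
      qed
      have "A - {y} = A" using yB' by auto
      then have eq': "A' = A \<union> {y}" "B' = B - {y}"
        using split_in[unfolded y'xy, OF side] by simp_all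
      have "B - {y} \<noteq> {}" using eq' AB'(3,4) by simp
      then have "card B > 1" by (rule big[OF yB])
      then show ?thesis using K eq' x'xy yB by blast
    next
      case False
      then have x'xy: "x' = y" and y'xy: "y' = x" using pair by (auto simp: doubleton_eq_iff)
      have side: "x \<notin> A'"
      proof (rule ccontr)
        assume "\<not> x \<notin> A'"
        then have "y' \<in> A'" using y'xy by simp
        note eq = split_in[OF this, unfolded y'xy]
        have "g \<in> N_cone x' A' B'"
          unfolding N_cone_partition_iff[OF AB'(2)] unfolding eq x'xy
          by (simp add: g del: insert_Diff_single)
        then show False using nF[OF gK] gxy by simp
      qed
      have "A - {y} = A" using yB' by auto
      then have eq': "A' = A" "B' = (B - {y}) \<union> {x}"
        using split_out[unfolded y'xy, OF side] by simp_all
      show ?thesis unfolding K eq' x'xy using yB by blast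
    qed
  qed
qed

section \<open>Extreme points and the bounds at the apex\<close>

lemma sum_coordinates_partition:
  fixes h :: "'a::finite \<Rightarrow> real"
  assumes "A \<inter> B = {}" "A \<union> B = - {x}"
  shows "(\<Sum>v\<in>UNIV. h v) = h x + (\<Sum>v\<in>A. h v) + (\<Sum>w\<in>B. h w)"
proof -
  have "UNIV = insert x (A \<union> B)" "x \<notin> A \<union> B" using assms by auto
  then have "(\<Sum>v\<in>UNIV. h v) = h x + (\<Sum>v\<in>A \<union> B. h v)" by (metis finite sum.insert)
  then show ?thesis using assms(1) by (simp only: sum.union_disjoint finite add.assoc)
qed

text \<open>The two inequalities say that the mass left over for the apex is admissible. The
  resulting vector is extreme because all coordinates but one sit at a bound and the last is fixed
  by the total mass.\<close>

lemma corresponds_to_extremeI: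
  fixes x :: "'a::finite"
  assumes coh: "coherent_PRI l u" and AB: "A \<inter> B = {}" "A \<union> B = - {x}"
    and lo: "l x \<le> 1 - (\<Sum>v\<in>A. l v) - (\<Sum>w\<in>B. u w)"
    and up: "1 - (\<Sum>v\<in>A. l v) - (\<Sum>w\<in>B. u w) \<le> u x"
  shows "corresponds_to_extreme l u (N_cone x A B)"
proof -
  \<comment> \<open>Nonnegativity of \<open>l v\<close> comes from coherence, by which it is a value
    attained by a probability.\<close>
  have lu: "l v \<le> u v" and l0: "0 \<le> l v" for v
    using coh by (auto simp: coherent_PRI_def credal_def prob_vectors_def) metis
  define P :: "real ^ 'a" where
    "P = (\<chi> v. if v \<in> A then l v else if v \<in> B then u v else 1 - (\<Sum>v\<in>A. l v) - (\<Sum>w\<in>B. u w))"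
  have PA: "P $ v = l v" if "v \<in> A" for v using that by (simp add: P_def)
  have PB: "P $ v = u v" if "v \<in> B" for v using that AB by (auto simp: P_def)
  have Px: "P $ x = 1 - (\<Sum>v\<in>A. l v) - (\<Sum>w\<in>B. u w)" using AB by (auto simp: P_def)
  have cases: "v = x \<or> v \<in> A \<or> v \<in> B" for v using AB by auto
  have bnd: "l v \<le> P $ v" "P $ v \<le> u v" for v
    using cases[of v] PA PB Px lo up lu[of v] by auto
  have PM: "P \<in> credal l u"
    unfolding credal_def prob_vectors_def
    using bnd order_trans[OF l0 bnd(1)] by (auto simp: sum_coordinates_partition[OF AB] PA PB Px)
  have mass: "(\<Sum>v\<in>UNIV. Q $ v) = 1" if "Q \<in> credal l u" for Q
    using that by (simp add: credal_def prob_vectors_def)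
  have "P extreme_point_of credal l u"
  proof -
    have False if Q: "Q \<in> credal l u" "R \<in> credal l u" "P \<in> open_segment Q R" for Q R
    proof -
      obtain t where t: "0 < t" "t < 1" "P = (1 - t) *\<^sub>R Q + t *\<^sub>R R" and ne: "Q \<noteq> R"
        using Q(3) by (auto simp: in_segment)
      have Pv: "P $ v = (1 - t) * Q $ v + t * R $ v" for v by (simp add: t(3))
      have b: "l v \<le> Q $ v" "Q $ v \<le> u v" "l v \<le> R $ v" "R $ v \<le> u v" for v
        using Q(1,2) by (auto simp: credal_def)
      have A: "Q $ v = R $ v" if "v \<in> A" for v
      proof -
        \<comment> \<open>Two nonnegative terms with sum zero both vanish, so each endpoint of the
          segment meets the bound too.\<close>
        have "(1 - t) * (Q $ v - l v) + t * (R $ v - l v) = 0"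
          using Pv[of v] PA[OF that] by (simp add: algebra_simps)
        moreover have "0 \<le> (1 - t) * (Q $ v - l v)" "0 \<le> t * (R $ v - l v)" using t b by auto
        ultimately have "(1 - t) * (Q $ v - l v) = 0" "t * (R $ v - l v) = 0" by linarith+
        then show ?thesis using t by simp
      qed
      have B: "Q $ v = R $ v" if "v \<in> B" for v
      proof -
        have "(1 - t) * (u v - Q $ v) + t * (u v - R $ v) = 0"
          using Pv[of v] PB[OF that] by (simp add: algebra_simps)
        moreover have "0 \<le> (1 - t) * (u v - Q $ v)" "0 \<le> t * (u v - R $ v)" using t b by auto
        ultimately have "(1 - t) * (u v - Q $ v) = 0" "t * (u v - R $ v) = 0" by linarith+
        then show ?thesis using t by simp
      qed
      have "Q $ x = R $ x"
        using mass[OF Q(1)] mass[OF Q(2)] A B by (simp add: sum_coordinates_partition[OF AB])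
      then have "Q = R" using A B cases by (metis vec_eq_iff)
      then show False using ne by simp
    qed
    then show ?thesis using PM by (auto simp: extreme_point_of_def)
  qed
  moreover have "N_cone x A B \<subseteq> normal_cone (credal l u) P"
  proof
    fix f assume f: "f \<in> N_cone x A B"
    have "Q \<bullet> f \<le> P \<bullet> f" if Q: "Q \<in> credal l u" for Q
    proof -
      \<comment> \<open>Both factors are nonpositive on \<open>A\<close>, both are nonnegative on
        \<open>B\<close>, and the second is zero at \<open>x\<close>. Subtracting
        \<open>f $ x\<close> is harmless in the sum because \<open>P\<close> and \<open>Q\<close>
        have equal total mass.\<close>
      have "(P $ v - Q $ v) * (f $ v - f $ x) \<ge> 0" for v
      proof -
        have "l v \<le> Q $ v" "Q $ v \<le> u v" using Q by (auto simp: credal_def)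
        then show ?thesis
          using cases[of v] f PA[of v] PB[of v]
          by (auto simp: N_cone_def mult_nonpos_nonpos)
      qed
      then have "0 \<le> (\<Sum>v\<in>UNIV. (P $ v - Q $ v) * (f $ v - f $ x))" by (simp add: sum_nonneg)
      also have "\<dots> = P \<bullet> f - Q \<bullet> f - ((\<Sum>v\<in>UNIV. P $ v) - (\<Sum>v\<in>UNIV. Q $ v)) * f $ x"
        by (simp add: inner_vec_def algebra_simps sum_subtractf sum.distrib sum_distrib_left)
      finally show ?thesis using mass[OF PM] mass[OF Q] by simp
    qed
    then show "f \<in> normal_cone (credal l u) P" by (simp add: normal_cone_def)
  qed
  ultimately show ?thesis unfolding corresponds_to_extreme_def by blast
qed

text \<open>The vectors \<open>- axis v 1\<close> on \<open>A\<close> and \<open>axis v 1\<close> on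
  \<open>B\<close> lie in the cone. Since \<open>P\<close> maximises them over the credal set and
  coherence makes the bounds attained, \<open>P\<close> meets \<open>l\<close> on \<open>A\<close>
  and \<open>u\<close> on \<open>B\<close>.\<close>

lemma corresponds_to_extremeD:
  fixes x :: "'a::finite"
  assumes coh: "coherent_PRI l u" and AB: "A \<inter> B = {}" "A \<union> B = - {x}"
    and corr: "corresponds_to_extreme l u (N_cone x A B)"
  shows "l x \<le> 1 - (\<Sum>v\<in>A. l v) - (\<Sum>w\<in>B. u w)"
    and "1 - (\<Sum>v\<in>A. l v) - (\<Sum>w\<in>B. u w) \<le> u x"
proof -
  obtain P where P: "P \<in> credal l u" "N_cone x A B \<subseteq> normal_cone (credal l u) P"
    using corr by (auto simp: corresponds_to_extreme_def extreme_point_of_def)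
  have b: "l v \<le> P $ v" "P $ v \<le> u v" for v using P(1) by (auto simp: credal_def)
  have PA: "P $ v = l v" if "v \<in> A" for v
  proof -
    obtain Q where Q: "Q \<in> credal l u" "Q $ v = l v"
      using coh unfolding coherent_PRI_def by blast
    have "- axis v 1 \<in> N_cone x A B" using AB that by (auto simp: N_cone_def axis_def)
    then have "Q \<bullet> (- axis v 1) \<le> P \<bullet> (- axis v 1)" using P(2) Q(1) by (auto simp: normal_cone_def)
    then show ?thesis using b(1)[of v] Q(2) by (simp add: inner_axis)
  qed
  have PB: "P $ v = u v" if "v \<in> B" for v
  proof -
    obtain Q where Q: "Q \<in> credal l u" "Q $ v = u v"
      using coh unfolding coherent_PRI_def by blast
    have "axis v 1 \<in> N_cone x A B" using AB that by (auto simp: N_cone_def axis_def)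
    then have "Q \<bullet> axis v 1 \<le> P \<bullet> axis v 1" using P(2) Q(1) by (auto simp: normal_cone_def)
    then show ?thesis using b(2)[of v] Q(2) by (simp add: inner_axis)
  qed
  have "(\<Sum>v\<in>UNIV. P $ v) = 1" using P(1) by (simp add: credal_def prob_vectors_def)
  then have "P $ x = 1 - (\<Sum>v\<in>A. l v) - (\<Sum>w\<in>B. u w)"
    by (simp add: sum_coordinates_partition[OF AB] PA PB)
  then show "l x \<le> 1 - (\<Sum>v\<in>A. l v) - (\<Sum>w\<in>B. u w)"
    and "1 - (\<Sum>v\<in>A. l v) - (\<Sum>w\<in>B. u w) \<le> u x"
    using b[of x] by simp_all
qed

theorem theorem4:
  fixes l u :: "'a::finite \<Rightarrow> real" and x :: 'a and A B :: "'a set"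
  assumes "coherent_PRI l u"
    and "A \<noteq> {}" and "B \<noteq> {}" and "A \<inter> B = {}" and "x \<notin> A \<union> B"
    and "is_MESC (N_cone x A B)"
    and "corresponds_to_extreme l u (N_cone x A B)"
  shows
    "{K. adjacent (N_cone x A B) K} =
        {N_cone y ((A - {y}) \<union> {x}) B | y. y \<in> A}
      \<union> {N_cone x (A - {y}) (B \<union> {y}) | y. y \<in> A \<and> card A > 1}
      \<union> {N_cone z A ((B - {z}) \<union> {x}) | z. z \<in> B}
      \<union> {N_cone x (A \<union> {z}) (B - {z}) | z. z \<in> B \<and> card B > 1}
     \<and>
     (\<forall>y\<in>A.
        (l x \<le> 1 - (\<Sum>v\<in>A - {y}. l v) - (\<Sum>w\<in>B \<union> {y}. u w)
           \<longrightarrow> corresponds_to_extreme l u (N_cone x (A - {y}) (B \<union> {y})))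
      \<and> (1 - (\<Sum>v\<in>(A - {y}) \<union> {x}. l v) - (\<Sum>w\<in>B. u w) \<le> u y
           \<longrightarrow> corresponds_to_extreme l u (N_cone y ((A - {y}) \<union> {x}) B)))
     \<and>
     (\<forall>z\<in>B.
        (1 - (\<Sum>w\<in>A \<union> {z}. l w) - (\<Sum>v\<in>B - {z}. u v) \<le> u x
           \<longrightarrow> corresponds_to_extreme l u (N_cone x (A \<union> {z}) (B - {z})))
      \<and> (l z \<le> 1 - (\<Sum>w\<in>A. l w) - (\<Sum>v\<in>(B - {z}) \<union> {x}. u v)
           \<longrightarrow> corresponds_to_extreme l u (N_cone z A ((B - {z}) \<union> {x}))))"
proof -
  note AB = assms(4) is_MESC_N_cone_partition[OF assms(6,5)] assms(2,3)
  have x: "x \<notin> A" "x \<notin> B" using assms(5) by auto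
  have lu: "l v \<le> u v" for v using assms(1) by (simp add: coherent_PRI_def)
  note ext = corresponds_to_extremeD[OF assms(1) AB(1,2) assms(7)]
  have ne: "C - {v} \<noteq> {}" if "card C > 1" for C and v :: 'a
    using that by (metis Diff_eq_empty_iff card.empty card_1_singleton_iff One_nat_def less_irrefl_nat not_less_zero subset_singletonD)
  \<comment> \<open>In (A2) and (B2) the tied point of the new cone is the old apex
    \<open>x\<close>; in (A1) and (B1) both cones have the same tied point. The tie follows in each
    case from opposite inequalities in the two cones.\<close>
  have A2: "adjacent (N_cone x A B) (N_cone y ((A - {y}) \<union> {x}) B)" if "y \<in> A" for y
  proof -
    have part: "((A - {y}) \<union> {x}) \<inter> B = {}" "((A - {y}) \<union> {x}) \<union> B = - {y}" "(A - {y}) \<union> {x} \<noteq> {}" "B \<noteq> {}"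
      using that AB x by auto
    show ?thesis
      by (rule adjacent_N_cone[OF AB _ part, of y x],
          unfold N_cone_partition_iff[OF part(2)] N_cone_partition_iff[OF AB(2)])
         (use that in auto)
  qed
  have A1: "adjacent (N_cone x A B) (N_cone x (A - {y}) (B \<union> {y}))" if "y \<in> A" "card A > 1" for y
  proof -
    have part: "(A - {y}) \<inter> (B \<union> {y}) = {}" "(A - {y}) \<union> (B \<union> {y}) = - {x}" "A - {y} \<noteq> {}" "B \<union> {y} \<noteq> {}"
      using that AB x ne[of A y] by auto
    show ?thesis
      by (rule adjacent_N_cone[OF AB _ part, of y y],
          unfold N_cone_partition_iff[OF part(2)] N_cone_partition_iff[OF AB(2)])
         (use that in auto)
  qed
  have B2: "adjacent (N_cone x A B) (N_cone z A ((B - {z}) \<union> {x}))" if "z \<in> B" for z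
  proof -
    have part: "A \<inter> ((B - {z}) \<union> {x}) = {}" "A \<union> ((B - {z}) \<union> {x}) = - {z}" "A \<noteq> {}" "(B - {z}) \<union> {x} \<noteq> {}"
      using that AB x by auto
    show ?thesis
      by (rule adjacent_N_cone[OF AB _ part, of z x],
          unfold N_cone_partition_iff[OF part(2)] N_cone_partition_iff[OF AB(2)])
         (use that in auto)
  qed
  have B1: "adjacent (N_cone x A B) (N_cone x (A \<union> {z}) (B - {z}))" if "z \<in> B" "card B > 1" for z
  proof -
    have part: "(A \<union> {z}) \<inter> (B - {z}) = {}" "(A \<union> {z}) \<union> (B - {z}) = - {x}" "A \<union> {z} \<noteq> {}" "B - {z} \<noteq> {}"
      using that AB x ne[of B z] by auto
    show ?thesis
      by (rule adjacent_N_cone[OF AB _ part, of z z],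
          unfold N_cone_partition_iff[OF part(2)] N_cone_partition_iff[OF AB(2)])
         (use that in auto)
  qed
  show ?thesis
  proof (intro conjI ballI impI)
    show "{K. adjacent (N_cone x A B) K} =
        {N_cone y ((A - {y}) \<union> {x}) B | y. y \<in> A}
      \<union> {N_cone x (A - {y}) (B \<union> {y}) | y. y \<in> A \<and> card A > 1}
      \<union> {N_cone z A ((B - {z}) \<union> {x}) | z. z \<in> B}
      \<union> {N_cone x (A \<union> {z}) (B - {z}) | z. z \<in> B \<and> card B > 1}" (is "?L = ?R")
    proof (rule equalityI)
      show "?L \<subseteq> ?R" using adjacent_imp_neighbour[OF AB] by blast
      show "?R \<subseteq> ?L" using A1 A2 B1 B2 by blast
    qed
  next
    fix y assume y: "y \<in> A"
    \<comment> \<open>Let t be the old mass at the apex. For (A1) the new mass is t + l(y) - u(y)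
      \<le> t \<le> u(x). For (A2) it is t + l(y) - l(x) \<ge> l(y). The other bound is the
      assumption in each case.\<close>
    have s: "(\<Sum>v\<in>A. l v) = l y + (\<Sum>v\<in>A - {y}. l v)" using y by (simp add: sum.remove)
    have s': "(\<Sum>v\<in>(A - {y}) \<union> {x}. l v) = l x + (\<Sum>v\<in>A - {y}. l v)" using x by simp
    have "y \<notin> B" using y AB by auto
    then have s'': "(\<Sum>w\<in>B \<union> {y}. u w) = u y + (\<Sum>w\<in>B. u w)" by simp
    {
      assume "l x \<le> 1 - (\<Sum>v\<in>A - {y}. l v) - (\<Sum>w\<in>B \<union> {y}. u w)"
      then show "corresponds_to_extreme l u (N_cone x (A - {y}) (B \<union> {y}))"
        using AB y ext lu[of y] unfolding s''
        by (intro corresponds_to_extremeI[OF assms(1)]) (auto simp: s s'' simp del: Un_insert_right)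
    next
      assume "1 - (\<Sum>v\<in>(A - {y}) \<union> {x}. l v) - (\<Sum>w\<in>B. u w) \<le> u y"
      then show "corresponds_to_extreme l u (N_cone y ((A - {y}) \<union> {x}) B)"
        using AB y x ext unfolding s'
        by (intro corresponds_to_extremeI[OF assms(1)]) (auto simp: s s' simp del: Un_insert_right)
    }
  next
    fix z assume z: "z \<in> B"
    \<comment> \<open>With t as the old mass at the apex, (B1) gives t + u(z) - l(z) \<ge> t \<ge>
      l(x), and (B2) gives t + u(z) - u(x) \<le> u(z).\<close>
    have s: "(\<Sum>v\<in>B. u v) = u z + (\<Sum>v\<in>B - {z}. u v)" using z by (simp add: sum.remove)
    have s': "(\<Sum>v\<in>(B - {z}) \<union> {x}. u v) = u x + (\<Sum>v\<in>B - {z}. u v)" using x by simp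
    have "z \<notin> A" using z AB by auto
    then have s'': "(\<Sum>w\<in>A \<union> {z}. l w) = l z + (\<Sum>w\<in>A. l w)" by simp
    {
      assume "1 - (\<Sum>w\<in>A \<union> {z}. l w) - (\<Sum>v\<in>B - {z}. u v) \<le> u x"
      then show "corresponds_to_extreme l u (N_cone x (A \<union> {z}) (B - {z}))"
        using AB z ext lu[of z] unfolding s''
        by (intro corresponds_to_extremeI[OF assms(1)]) (auto simp: s s'' simp del: Un_insert_right)
    next
      assume "l z \<le> 1 - (\<Sum>w\<in>A. l w) - (\<Sum>v\<in>(B - {z}) \<union> {x}. u v)"
      then show "corresponds_to_extreme l u (N_cone z A ((B - {z}) \<union> {x}))"
        using AB z x ext unfolding s'
        by (intro corresponds_to_extremeI[OF assms(1)]) (auto simp: s s' simp del: Un_insert_right)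
    }
  qed
qed

end
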